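(* Let $m>0$. For signs $\pm_1,\pm_2\in\{+,-\}$ and nonzero $\eta,\zeta\in\mathbb{R}^3$ let $$\mathfrak a_{(\pm_1,\pm_2)}(\eta,\zeta)=\langle\zeta\rangle_m-\frac{(\pm_1\eta)\cdot(\pm_2\zeta)}{|\eta|}$$ (up to multiplication by an absolute constant). Then there is an absolute constant $C$ such that, for all signs $\pm_1,\pm_2$ and all nonzero $\eta,\zeta\in\mathbb{R}^3$, $$\left|\mathfrak a_{(\pm_1,\pm_2)}(\eta,\zeta)\right|\le C\bigl(m+|\zeta|\,\theta(\pm_1\eta,\pm_2\zeta)\bigr).$$
   Context: $\langle\zeta\rangle_m=\sqrt{m^2+|\zeta|^2}$, and $\theta(\eta,\zeta)\in[0,\pi]$ denotes the angle between nonzero vectors $\eta,\zeta\in\mathbb{R}^3$. The function $\mathfrak a_{(\pm_1,\pm_2)}$ is the symbol (up to an absolute constant factor, coming from the normalization of the Fourier transform) of the bilinear operator $\mathfrak A_{(\pm_1,\pm_2)}(f,g)=f\langle\nabla\rangle_m g+|\nabla|^{-1}\nabla(\pm_1f)\cdot\nabla(\pm_2g)$ acting on functions on $\mathbb{R}^3$, where $|\nabla|$ and $\langle\nabla\rangle_m$ are the Fourier multipliers with symbols $|\xi|$ and $\langle\xi\rangle_m$; that is, $\widehat{\mathfrak A_{(\pm_1,\pm_2)}(f,g)}(\xi)=\int_{\mathbb{R}^3}\mathfrak a_{(\pm_1,\pm_2)}(\eta,\xi-\eta)\widehat f(\eta)\widehat g(\xi-\eta)\,d\eta$. *)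

theory Defs
  imports "HOL-Analysis.Analysis"
begin

definition japanese_bracket :: "real \<Rightarrow> real ^ 3 \<Rightarrow> real" where
  "japanese_bracket m \<zeta> = sqrt (m\<^sup>2 + (norm \<zeta>)\<^sup>2)"

text \<open>The angle in \<open>[0, pi]\<close>; meaningful for nonzero vectors only (the value for a
  zero vector is \<open>pi / 2\<close>, since division by zero yields zero).\<close>

definition vec_angle :: "real ^ 3 \<Rightarrow> real ^ 3 \<Rightarrow> real" where
  "vec_angle \<eta> \<zeta> = arccos ((\<eta> \<bullet> \<zeta>) / (norm \<eta> * norm \<zeta>))"

text \<open>The symbol of \<open>f \<langle>\<nabla>\<rangle>\<^sub>m g + |\<nabla>|\<^sup>-\<^sup>1 \<nabla> (\<plusminus>\<^sub>1 f) \<cdot> \<nabla> (\<plusminus>\<^sub>2 g)\<close>: the two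
  gradients contribute a factor \<open>\<i>\<^sup>2 = -1\<close>, whence the minus sign. The real factor \<open>c\<close> is the
  constant coming from the normalization of the Fourier transform. The signs are encoded as
  real numbers \<open>s\<^sub>1, s\<^sub>2 \<in> {1, -1}\<close>.\<close>

definition symbol_a :: "real \<Rightarrow> real \<Rightarrow> real \<Rightarrow> real \<Rightarrow> real ^ 3 \<Rightarrow> real ^ 3 \<Rightarrow> real" where
  "symbol_a c m s\<^sub>1 s\<^sub>2 \<eta> \<zeta> =
     c * (japanese_bracket m \<zeta> - ((s\<^sub>1 *\<^sub>R \<eta>) \<bullet> (s\<^sub>2 *\<^sub>R \<zeta>)) / norm \<eta>)"

end

theory Submission
  imports Defs
begin

text \<open>Let \<open>\<theta>\<close> be the angle between the signed vectors. Signs do not change norms, so the symbol equals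
  \<open>c (\<langle>\<zeta>\<rangle>\<^sub>m - |\<zeta>| cos \<theta>)\<close>. The bracket lies between \<open>|\<zeta>|\<close> and \<open>m + |\<zeta>|\<close>; hence the difference is
  nonnegative and at most \<open>m + |\<zeta>| (1 - cos \<theta>)\<close>. A linear bound \<open>1 - cos \<theta> \<le> \<theta>\<close> then gives the claim
  with \<open>C = |c|\<close>. The term \<open>m\<close> thus measures how far the bracket is from \<open>|\<zeta>|\<close>, and the angular
  term how far the signed vectors are from pointing in the same direction: the null structure of the bilinear operator.\<close>

text \<open>The half-angle formula \<open>1 - cos x = 2 sin\<^sup>2 (x / 2)\<close> gives the bound once one factor \<open>sin (x / 2)\<close>
  is bounded by \<open>1\<close> and the other one by \<open>x / 2\<close>.\<close>

lemma one_minus_cos_le: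
  fixes x :: real
  assumes "0 \<le> x"
  shows "1 - cos x \<le> x"
proof -
  have "1 - cos x = 2 * (sin (x / 2))\<^sup>2"
    using cos_double_sin[of "x / 2"] by simp
  also have "(sin (x / 2))\<^sup>2 \<le> \<bar>sin (x / 2)\<bar>"
    using mult_left_le[of "\<bar>sin (x / 2)\<bar>" "\<bar>sin (x / 2)\<bar>"]
    by (simp add: power2_eq_square)
  also have "\<dots> \<le> x / 2"
    using abs_sin_x_le_abs_x[of "x / 2"] assms by simp
  finally show ?thesis by simp
qed

text \<open>By the Cauchy--Schwarz inequality the quotient in the definition of the angle lies in the
  domain \<open>[-1, 1]\<close> of the arc cosine; with \<open>x / 0 = 0\<close> this includes zero vectors.\<close>

lemma cosine_quotient_bounds:
  fixes u v :: "'a::real_inner"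
  shows "\<bar>(u \<bullet> v) / (norm u * norm v)\<bar> \<le> 1"
  using Cauchy_Schwarz_ineq2[of u v] by (auto simp: divide_le_eq_1 zero_less_mult_iff)

lemma vec_angle_nonneg: "0 \<le> vec_angle u v"
  unfolding vec_angle_def using cosine_quotient_bounds[of u v] by (intro arccos_lbound) linarith+

lemma inner_eq_cos_vec_angle: "u \<bullet> v = norm u * norm v * cos (vec_angle u v)"
  unfolding vec_angle_def using cosine_quotient_bounds[of u v] by (simp add: cos_arccos_abs)

lemma norm_le_japanese_bracket: "norm \<zeta> \<le> japanese_bracket m \<zeta>"
  unfolding japanese_bracket_def by (rule real_le_rsqrt) simp

lemma japanese_bracket_le:
  assumes "0 \<le> m"
  shows "japanese_bracket m \<zeta> \<le> m + norm \<zeta>"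
  unfolding japanese_bracket_def using assms by (intro sqrt_sum_squares_le_sum) auto

theorem lemma3p1:
  fixes c :: real
  shows "\<exists>C::real. \<forall>m>0. \<forall>s\<^sub>1\<in>{1, -1}. \<forall>s\<^sub>2\<in>{1, -1}. \<forall>\<eta> \<zeta> :: real ^ 3.
    \<eta> \<noteq> 0 \<longrightarrow> \<zeta> \<noteq> 0 \<longrightarrow>
      \<bar>symbol_a c m s\<^sub>1 s\<^sub>2 \<eta> \<zeta>\<bar>
        \<le> C * (m + norm \<zeta> * vec_angle (s\<^sub>1 *\<^sub>R \<eta>) (s\<^sub>2 *\<^sub>R \<zeta>))"
proof (intro exI[of _ "\<bar>c\<bar>"] allI ballI impI)
  fix m s\<^sub>1 s\<^sub>2 :: real and \<eta> \<zeta> :: "real ^ 3"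
  assume m: "0 < m" and s: "s\<^sub>1 \<in> {1, -1}" "s\<^sub>2 \<in> {1, -1}" and "\<eta> \<noteq> 0" "\<zeta> \<noteq> 0"
  define \<theta> where "\<theta> = vec_angle (s\<^sub>1 *\<^sub>R \<eta>) (s\<^sub>2 *\<^sub>R \<zeta>)"
  let ?d = "japanese_bracket m \<zeta> - norm \<zeta> * cos \<theta>"
  have "norm (s\<^sub>1 *\<^sub>R \<eta>) = norm \<eta>" "norm (s\<^sub>2 *\<^sub>R \<zeta>) = norm \<zeta>"
    using s by auto
  then have "((s\<^sub>1 *\<^sub>R \<eta>) \<bullet> (s\<^sub>2 *\<^sub>R \<zeta>)) / norm \<eta> = norm \<zeta> * cos \<theta>"
    using \<open>\<eta> \<noteq> 0\<close> inner_eq_cos_vec_angle[of "s\<^sub>1 *\<^sub>R \<eta>" "s\<^sub>2 *\<^sub>R \<zeta>"]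
    unfolding \<theta>_def by (simp del: inner_scaleR_left inner_scaleR_right norm_scaleR)
  then have symbol: "symbol_a c m s\<^sub>1 s\<^sub>2 \<eta> \<zeta> = c * ?d"
    unfolding symbol_a_def by simp
  have "norm \<zeta> * cos \<theta> \<le> norm \<zeta>"
    by (simp add: mult_left_le)
  then have nonneg: "0 \<le> ?d"
    using norm_le_japanese_bracket[of \<zeta> m] by linarith
  have "norm \<zeta> * (1 - cos \<theta>) \<le> norm \<zeta> * \<theta>"
    unfolding \<theta>_def by (intro mult_left_mono one_minus_cos_le vec_angle_nonneg norm_ge_zero)
  then have "?d \<le> m + norm \<zeta> * \<theta>"
    using japanese_bracket_le[of m \<zeta>] m by (simp add: right_diff_distrib)
  then have "\<bar>c\<bar> * ?d \<le> \<bar>c\<bar> * (m + norm \<zeta> * \<theta>)"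
    by (intro mult_left_mono) simp_all
  then show "\<bar>symbol_a c m s\<^sub>1 s\<^sub>2 \<eta> \<zeta>\<bar> \<le>
      \<bar>c\<bar> * (m + norm \<zeta> * vec_angle (s\<^sub>1 *\<^sub>R \<eta>) (s\<^sub>2 *\<^sub>R \<zeta>))"
    using nonneg unfolding symbol \<theta>_def[symmetric] by (simp add: abs_mult)
qed

end
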